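(* Let $G$ be a uniform grid with associated integer $N$. For every $E\subsetneq[0,N]$: (a) $\mathsf{PC}_G(E)=\min\{d\in[0,N]:\mathrm{Z^*cl}_{G,d}(E)\ne[0,N]\}$; (b) $\mathsf{PPC}_G(E)=\min\{d\in[0,N]:\mathrm{Z^*cl}_{G,d}(E)=E\}$.
   Context: For integers $a\le b$, $[a,b]$ denotes the set of integers $t$ with $a\le t\le b$; $[n]=[1,n]$. A uniform grid is a set $G=[0,k_1-1]\times\cdots\times[0,k_n-1]\subseteq\mathbb{R}^n$ with $n\ge1$ and integers $k_i\ge2$; put $N=\sum_{i\in[n]}(k_i-1)$. The weight of $x\in G$ is $\mathrm{wt}(x)=\sum_{i\in[n]}x_i$. For $E\subseteq[0,N]$ let $\underline{E}=\{x\in G:\mathrm{wt}(x)\in E\}$, and $\underline{j}=\underline{\{j\}}$. For $P\in\mathbb{R}[X_1,\ldots,X_n]$ let $\mathcal{Z}_G(P)=\{a\in G:P(a)=0\}$. For $E\subsetneq[0,N]$, $P$ is a nontrivial polynomial cover of $\underline{E}$ if $\underline{E}\subseteq\mathcal{Z}_G(P)\ne G$; it is a proper polynomial cover of $\underline{E}$ if $\underline{E}\subseteq\mathcal{Z}_G(P)$ and $\underline{j}\not\subseteq\mathcal{Z}_G(P)$ for every $j\in[0,N]\setminus E$. $\mathsf{PC}_G(E)$ and $\mathsf{PPC}_G(E)$ denote the minimum degree of a nontrivial polynomial cover, respectively of a proper polynomial cover, of $\underline{E}$. For $d\in[0,N]$ and $S\subseteq G$, $\mathrm{Zcl}_{G,d}(S)$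 is the set of all $a\in G$ such that $P(a)=0$ for every $P\in\mathbb{R}[X_1,\ldots,X_n]$ of degree at most $d$ (zero polynomial included) that vanishes on $S$. For $E\subseteq[0,N]$, $\mathrm{Z^*cl}_{G,d}(E)=\{j\in[0,N]:\underline{j}\subseteq\mathrm{Zcl}_{G,d}(\underline{E})\}$. *)

theory Defs
  imports "HOL-Analysis.Finite_Cartesian_Product" "HOL-Library.Poly_Mapping"
begin

section \<open>Real polynomials in finitely many variables\<close>

text \<open>
  The coordinates are indexed by an arbitrary finite type \<open>'n\<close> (nonempty, like every type) with
  \<open>n = CARD('n)\<close> elements. A monomial is its exponent vector, and a polynomial assigns real
  coefficients to finitely many monomials, so \<open>'n mpoly\<close> is the whole ring
  \<open>\<real>[X\<^sub>1, \<dots>, X\<^sub>n]\<close>.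
\<close>

type_synonym 'n mpoly = "('n \<Rightarrow>\<^sub>0 nat) \<Rightarrow>\<^sub>0 real"

definition mono_eval :: "('n::finite \<Rightarrow>\<^sub>0 nat) \<Rightarrow> real ^ 'n \<Rightarrow> real" where
  "mono_eval m x = (\<Prod>i\<in>UNIV. (x $ i) ^ Poly_Mapping.lookup m i)"

definition mpoly_eval :: "('n::finite) mpoly \<Rightarrow> real ^ 'n \<Rightarrow> real" where
  "mpoly_eval P x = (\<Sum>m\<in>Poly_Mapping.keys P. Poly_Mapping.lookup P m * mono_eval m x)"

definition mono_degree :: "('n::finite \<Rightarrow>\<^sub>0 nat) \<Rightarrow> nat" where
  "mono_degree m = (\<Sum>i\<in>UNIV. Poly_Mapping.lookup m i)"

text \<open>The total degree; the zero polynomial gets degree 0, so it has degree at most every \<open>d\<close>.\<close>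

definition total_degree :: "('n::finite) mpoly \<Rightarrow> nat" where
  "total_degree P = Max (insert 0 (mono_degree ` Poly_Mapping.keys P))"

section \<open>Uniform grids\<close>

text \<open>
  The grid with side lengths \<open>k\<close> is \<open>[0, k\<^sub>1 - 1] \<times> \<dots> \<times> [0, k\<^sub>n - 1]\<close>, as a subset of \<open>\<real>\<^sup>n\<close>.
\<close>

definition uniform_sides :: "('n::finite \<Rightarrow> nat) \<Rightarrow> bool" where
  "uniform_sides k \<longleftrightarrow> (\<forall>i. k i \<ge> 2)"

definition grid :: "('n::finite \<Rightarrow> nat) \<Rightarrow> (real ^ 'n) set" where
  "grid k = {x. \<forall>i. x $ i \<in> real ` {0..k i - 1}}"

definition grid_N :: "('n::finite \<Rightarrow> nat) \<Rightarrow> nat" where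
  "grid_N k = (\<Sum>i\<in>UNIV. k i - 1)"

definition wt :: "real ^ ('n::finite) \<Rightarrow> real" where
  "wt x = (\<Sum>i\<in>UNIV. x $ i)"

definition layers :: "('n::finite \<Rightarrow> nat) \<Rightarrow> nat set \<Rightarrow> (real ^ 'n) set" where
  "layers k E = {x \<in> grid k. wt x \<in> real ` E}"

section \<open>Polynomial covers\<close>

definition zeros :: "('n::finite \<Rightarrow> nat) \<Rightarrow> 'n mpoly \<Rightarrow> (real ^ 'n) set" where
  "zeros k P = {a \<in> grid k. mpoly_eval P a = 0}"

definition nontrivial_cover :: "('n::finite \<Rightarrow> nat) \<Rightarrow> nat set \<Rightarrow> 'n mpoly \<Rightarrow> bool" where
  "nontrivial_cover k E P \<longleftrightarrow> layers k E \<subseteq> zeros k P \<and> zeros k P \<noteq> grid k"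

definition proper_cover :: "('n::finite \<Rightarrow> nat) \<Rightarrow> nat set \<Rightarrow> 'n mpoly \<Rightarrow> bool" where
  "proper_cover k E P \<longleftrightarrow> layers k E \<subseteq> zeros k P \<and>
     (\<forall>j\<in>{0..grid_N k} - E. \<not> layers k {j} \<subseteq> zeros k P)"

text \<open>
  Covers of both kinds exist whenever \<open>E\<close> is a proper subset of \<open>{0..grid_N k}\<close>; see
  \<open>nontrivial_cover_exists\<close> and \<open>proper_cover_exists\<close> below.
\<close>

definition PC :: "('n::finite \<Rightarrow> nat) \<Rightarrow> nat set \<Rightarrow> nat" where
  "PC k E = (LEAST d. \<exists>P. nontrivial_cover k E P \<and> total_degree P = d)"

definition PPC :: "('n::finite \<Rightarrow> nat) \<Rightarrow> nat set \<Rightarrow> nat" where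
  "PPC k E = (LEAST d. \<exists>P. proper_cover k E P \<and> total_degree P = d)"

section \<open>Closures\<close>

definition Zcl :: "('n::finite \<Rightarrow> nat) \<Rightarrow> nat \<Rightarrow> (real ^ 'n) set \<Rightarrow> (real ^ 'n) set" where
  "Zcl k d S = {a \<in> grid k. \<forall>P. total_degree P \<le> d \<and> (\<forall>x\<in>S. mpoly_eval P x = 0)
     \<longrightarrow> mpoly_eval P a = 0}"

definition Zstar_cl :: "('n::finite \<Rightarrow> nat) \<Rightarrow> nat \<Rightarrow> nat set \<Rightarrow> nat set" where
  "Zstar_cl k d E = {j \<in> {0..grid_N k}. layers k {j} \<subseteq> Zcl k d (layers k E)}"

section \<open>Well-definedness of the minima\<close>

lemma total_degree_le_iff:
  "total_degree P \<le> d \<longleftrightarrow> (\<forall>m\<in>Poly_Mapping.keys P. mono_degree m \<le> d)"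
  by (simp add: total_degree_def)

lemma mpoly_eval_superset:
  assumes "finite A" "Poly_Mapping.keys P \<subseteq> A"
  shows "mpoly_eval P x = (\<Sum>m\<in>A. Poly_Mapping.lookup P m * mono_eval m x)"
  unfolding mpoly_eval_def using assms
  by (intro sum.mono_neutral_left) (auto simp: in_keys_iff)

lemma mpoly_eval_add: "mpoly_eval (P + Q) x = mpoly_eval P x + mpoly_eval Q x"
proof -
  let ?A = "Poly_Mapping.keys P \<union> Poly_Mapping.keys Q"
  have "mpoly_eval R x = (\<Sum>m\<in>?A. Poly_Mapping.lookup R m * mono_eval m x)"
    if "R \<in> {P, Q, P + Q}" for R
    using that keys_add[of P Q] by (intro mpoly_eval_superset) auto
  then show ?thesis
    by (simp add: lookup_add distrib_right sum.distrib)
qed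

lemma total_degree_add:
  assumes "total_degree P \<le> d" "total_degree Q \<le> d"
  shows "total_degree (P + Q) \<le> d"
  using assms keys_add[of P Q] unfolding total_degree_le_iff by blast

definition representable :: "nat \<Rightarrow> (real ^ ('n::finite) \<Rightarrow> real) \<Rightarrow> bool" where
  "representable d f \<longleftrightarrow> (\<exists>P. total_degree P \<le> d \<and> (\<forall>x. mpoly_eval P x = f x))"

lemma representable_mono:
  assumes "mono_degree m \<le> d"
  shows "representable d (\<lambda>x. c * mono_eval m x)"
  unfolding representable_def
proof (intro exI conjI allI)
  show "total_degree (Poly_Mapping.single m c) \<le> d"
    using assms by (simp add: total_degree_le_iff)
  show "mpoly_eval (Poly_Mapping.single m c) x = c * mono_eval m x" for x
    by (subst mpoly_eval_superset[of "{m}"]) simp_all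
qed

lemma representable_add:
  "representable d f \<Longrightarrow> representable d g \<Longrightarrow> representable d (\<lambda>x. f x + g x)"
  unfolding representable_def by (metis mpoly_eval_add total_degree_add)

lemma representable_zero: "representable d (\<lambda>x. 0)"
  using representable_mono[of 0 d 0] by (simp add: mono_degree_def)

lemma representable_sum:
  "finite A \<Longrightarrow> (\<And>a. a \<in> A \<Longrightarrow> representable d (f a)) \<Longrightarrow> representable d (\<lambda>x. \<Sum>a\<in>A. f a x)"
  by (induction A rule: finite_induct) (auto intro: representable_zero representable_add)

lemma representable_linear_mult:
  assumes "representable d f"
  shows "representable (Suc d) (\<lambda>x. (c * x $ i + b) * f x)"
proof -
  obtain P where P: "total_degree P \<le> d" "\<And>x. mpoly_eval P x = f x"
    using assms by (auto simp: representable_def)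
  let ?e = "Poly_Mapping.single i (1::nat)"
  have me: "mono_eval (m + ?e) x = x $ i * mono_eval m x" for m x
  proof -
    have "mono_eval ?e x = (\<Prod>j\<in>UNIV. if j = i then x $ i else 1)"
      unfolding mono_eval_def by (rule prod.cong) (auto simp: lookup_single when_def)
    then have "mono_eval ?e x = x $ i" by simp
    moreover have "mono_eval (m + ?e) x = mono_eval m x * mono_eval ?e x"
      by (simp add: mono_eval_def lookup_add power_add prod.distrib)
    ultimately show ?thesis by simp
  qed
  have "mono_degree ?e = (\<Sum>j\<in>UNIV. if j = i then 1 else 0)"
    unfolding mono_degree_def by (rule sum.cong) (auto simp: lookup_single when_def)
  then have "mono_degree ?e = 1" by simp
  then have md: "mono_degree (m + ?e) = Suc (mono_degree m)" for m
    by (simp add: mono_degree_def lookup_add sum.distrib)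
  have "representable (Suc d) (\<lambda>x. \<Sum>m\<in>Poly_Mapping.keys P.
      (c * Poly_Mapping.lookup P m) * mono_eval (m + ?e) x +
      (b * Poly_Mapping.lookup P m) * mono_eval m x)"
    using P(1) by (intro representable_sum representable_add representable_mono)
      (auto simp: md[unfolded One_nat_def] total_degree_le_iff le_SucI)
  also have "(\<lambda>x. \<Sum>m\<in>Poly_Mapping.keys P.
      (c * Poly_Mapping.lookup P m) * mono_eval (m + ?e) x +
      (b * Poly_Mapping.lookup P m) * mono_eval m x) = (\<lambda>x. (c * x $ i + b) * f x)"
    unfolding P(2)[symmetric] mpoly_eval_def
    by (simp add: me[unfolded One_nat_def] algebra_simps sum_distrib_left sum.distrib)
  finally show ?thesis .
qed

lemma representable_prod:
  fixes c b :: "'n::finite \<times> 'a \<Rightarrow> real"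
  assumes "finite S"
  shows "representable (card S) (\<lambda>x. \<Prod>p\<in>S. (c p * x $ fst p + b p))"
  using assms
proof (induction S rule: finite_induct)
  case empty
  show ?case
    using representable_mono[of 0 0 1] by (simp add: mono_eval_def mono_degree_def)
next
  case (insert p S)
  then show ?case
    using representable_linear_mult[OF insert.IH, of "c p" "fst p" "b p"] by simp
qed

lemma grid_finite: "finite (grid k)"
proof (rule finite_subset)
  show "grid k \<subseteq> (\<lambda>f. \<chi> i. f i) ` (PiE UNIV (\<lambda>i. real ` {0..k i - 1}))"
  proof
    fix x assume "x \<in> grid k"
    then show "x \<in> (\<lambda>f. \<chi> i. f i) ` (PiE UNIV (\<lambda>i. real ` {0..k i - 1}))"
      by (intro image_eqI[of _ _ "\<lambda>i. x $ i"]) (auto simp: grid_def PiE_UNIV_domain)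
  qed
  show "finite ((\<lambda>f. \<chi> i. f i) ` (PiE UNIV (\<lambda>i. real ` {0..k i - 1})) :: (real ^ _) set)"
    by (intro finite_imageI finite_PiE) auto
qed

lemma grid_point_indicator:
  assumes a: "a \<in> grid k"
  shows "\<exists>f. representable (grid_N k) f \<and> (\<forall>x\<in>grid k. f x = (if x = a then 1 else 0))"
proof -
  have "\<forall>i. \<exists>t. t \<le> k i - 1 \<and> a $ i = real t" using a unfolding grid_def by fastforce
  then obtain u where u: "\<And>i. u i \<le> k i - 1" "\<And>i. a $ i = real (u i)" by metis
  let ?S = "SIGMA i:UNIV. {0..k i - 1} - {u i}"
  define c where "c p = 1 / (real (u (fst p)) - real (snd p))" for p
  define b where "b p = - real (snd p) * c p" for p
  have S: "finite ?S" by auto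
  have card: "card ?S = grid_N k"
    using u(1) by (simp add: grid_N_def)
  let ?f = "\<lambda>x. \<Prod>p\<in>?S. (c p * x $ fst p + b p)"
  have "representable (grid_N k) ?f"
    using representable_prod[OF S, of c b] by (simp only: card)
  moreover have "?f x = (if x = a then 1 else 0)" if x: "x \<in> grid k" for x
  proof (cases "x = a")
    case True
    have "c p * a $ fst p + b p = 1" if "p \<in> ?S" for p
    proof -
      have "c p * a $ fst p + b p = c p * (real (u (fst p)) - real (snd p))"
        by (simp add: b_def u(2) algebra_simps)
      also have "\<dots> = 1" using that by (auto simp: c_def)
      finally show ?thesis .
    qed
    then show ?thesis using True by simp
  next
    case False
    then obtain i where i: "x $ i \<noteq> a $ i" by (auto simp: vec_eq_iff)
    from x obtain t where t: "t \<le> k i - 1" "x $ i = real t" unfolding grid_def by fastforce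
    have "(i, t) \<in> ?S" using t i u(2)[of i] by auto
    moreover have "c (i, t) * x $ fst (i, t) + b (i, t) = 0" by (simp add: b_def t)
    ultimately have "?f x = 0" using S by (meson prod_zero)
    then show ?thesis using False by simp
  qed
  ultimately show ?thesis by blast
qed

lemma grid_subset_cover:
  assumes "S \<subseteq> grid k"
  shows "\<exists>P. total_degree P \<le> grid_N k \<and> zeros k P = S"
proof -
  obtain f where f: "\<And>a. a \<in> grid k \<Longrightarrow> representable (grid_N k) (f a)"
      "\<And>a x. a \<in> grid k \<Longrightarrow> x \<in> grid k \<Longrightarrow> f a x = (if x = a then 1 else 0)"
    using grid_point_indicator[of _ k] by metis
  have "representable (grid_N k) (\<lambda>x. \<Sum>a\<in>grid k - S. f a x)"
    using f(1) grid_finite by (intro representable_sum) auto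
  then obtain P where P: "total_degree P \<le> grid_N k"
      "\<And>x. mpoly_eval P x = (\<Sum>a\<in>grid k - S. f a x)"
    by (auto simp: representable_def)
  have "mpoly_eval P x = (if x \<in> S then 0 else 1)" if "x \<in> grid k" for x
  proof -
    have "mpoly_eval P x = (\<Sum>a\<in>grid k - S. if x = a then 1 else 0)"
      unfolding P(2) using that by (intro sum.cong) (auto simp: f(2))
    then show ?thesis using that by (simp add: grid_finite)
  qed
  then have "zeros k P = S" using assms by (auto simp: zeros_def split: if_splits)
  with P(1) show ?thesis by blast
qed

lemma layer_nonempty:
  assumes "j \<le> grid_N k"
  shows "layers k {j} \<noteq> {}"
proof -
  have "\<exists>v. (\<forall>i. v i \<le> k i - 1) \<and> sum v UNIV = j" using assms
  proof (induction j)
    case 0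
    show ?case by (intro exI[of _ "\<lambda>_. 0"]) auto
  next
    case (Suc j)
    then obtain v where v: "\<And>i. v i \<le> k i - 1" "sum v UNIV = j" by auto
    have "\<exists>i. v i < k i - 1"
    proof (rule ccontr)
      assume "\<not> ?thesis"
      then have "grid_N k \<le> sum v UNIV"
        unfolding grid_N_def by (intro sum_mono) (simp add: not_less)
      with v(2) Suc.prems show False by simp
    qed
    then obtain i where i: "v i < k i - 1" by blast
    have "sum (v(i := Suc (v i))) UNIV = Suc j"
      using v(2) by (simp add: sum.remove[of UNIV i])
    then show ?case using v(1) i by (intro exI[of _ "v(i := Suc (v i))"]) auto
  qed
  then obtain v where v: "\<And>i. v i \<le> k i - 1" "sum v UNIV = j" by auto
  have "(\<chi> i. real (v i)) \<in> layers k {j}"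
    using v(1) by (auto simp: layers_def grid_def wt_def simp flip: v(2))
  then show ?thesis by blast
qed

lemma layers_disjoint: "j \<notin> E \<Longrightarrow> layers k {j} \<inter> layers k E = {}"
  by (auto simp: layers_def)

lemma proper_cover_exists:
  "\<exists>P. proper_cover k E P \<and> total_degree P \<le> grid_N k"
proof -
  obtain P where P: "total_degree P \<le> grid_N k" "zeros k P = layers k E"
    using grid_subset_cover[of "layers k E" k] by (auto simp: layers_def)
  have "\<not> layers k {j} \<subseteq> layers k E" if "j \<in> {0..grid_N k} - E" for j
    using that layer_nonempty[of j k] layers_disjoint[of j E k] by auto
  with P show ?thesis by (auto simp: proper_cover_def)
qed

lemma nontrivial_cover_exists:
  assumes "E \<subset> {0..grid_N k}"
  shows "\<exists>P. nontrivial_cover k E P \<and> total_degree P \<le> grid_N k"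
proof -
  obtain P where P: "proper_cover k E P" "total_degree P \<le> grid_N k"
    using proper_cover_exists by blast
  obtain j where j: "j \<in> {0..grid_N k} - E" using assms by blast
  have "zeros k P \<noteq> grid k"
    using P(1) j unfolding proper_cover_def layers_def by blast
  with P show ?thesis by (auto simp: proper_cover_def nontrivial_cover_def)
qed

lemma Zstar_cl_grid_N:
  assumes "E \<subseteq> {0..grid_N k}"
  shows "Zstar_cl k (grid_N k) E = E"
proof (rule set_eqI)
  fix j
  obtain P where P: "proper_cover k E P" "total_degree P \<le> grid_N k"
    using proper_cover_exists by blast
  have "j \<notin> Zstar_cl k (grid_N k) E" if "j \<in> {0..grid_N k} - E"
  proof
    assume "j \<in> Zstar_cl k (grid_N k) E"
    then have "layers k {j} \<subseteq> zeros k P"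
      using P unfolding Zstar_cl_def Zcl_def proper_cover_def zeros_def by blast
    with that P(1) show False by (auto simp: proper_cover_def)
  qed
  moreover have "j \<in> Zstar_cl k (grid_N k) E" if "j \<in> E"
    using that assms by (auto simp: Zstar_cl_def Zcl_def layers_def)
  ultimately show "j \<in> Zstar_cl k (grid_N k) E \<longleftrightarrow> j \<in> E"
    by (auto simp: Zstar_cl_def)
qed

end

theory Submission
  imports Defs
begin

text \<open>
  A grid point lies outside the closure of \<open>layers k E\<close> exactly when some polynomial of degree at
  most \<open>d\<close> vanishes on \<open>layers k E\<close> but not at that point. So (a) is immediate, and (b) comes down
  to finding one polynomial that is nonzero at prescribed points, one in each layer outside
  \<open>E\<close>, given a separate polynomial for each of them: a generic linear combination works.
\<close>

lemma representable_cmult: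
  assumes "representable d f"
  shows "representable d (\<lambda>x. c * f x)"
proof -
  obtain P where P: "total_degree P \<le> d" "\<And>x. mpoly_eval P x = f x"
    using assms by (auto simp: representable_def)
  have "representable d (\<lambda>x. \<Sum>m\<in>Poly_Mapping.keys P. (c * Poly_Mapping.lookup P m) * mono_eval m x)"
    using P(1) by (intro representable_sum representable_mono) (auto simp: total_degree_le_iff)
  then show ?thesis
    by (simp add: P(2)[symmetric] mpoly_eval_def sum_distrib_left mult.assoc)
qed

text \<open>By induction, combine \<open>P\<close> for the old points with \<open>Q\<close> for the
  new one into \<open>P + c Q\<close>. Each point excludes at most one scalar \<open>c\<close>, and
  the field is infinite.\<close>

lemma common_nonvanishing:
  assumes "finite A"
    and "\<And>a. a \<in> A \<Longrightarrow> \<exists>P. total_degree P \<le> d \<and> (\<forall>x\<in>S. mpoly_eval P x = 0) \<and> mpoly_eval P a \<noteq> 0"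
  shows "\<exists>P. total_degree P \<le> d \<and> (\<forall>x\<in>S. mpoly_eval P x = 0) \<and> (\<forall>a\<in>A. mpoly_eval P a \<noteq> 0)"
  using assms
proof (induction A rule: finite_induct)
  case empty
  show ?case by (intro exI[of _ 0]) (simp add: total_degree_def mpoly_eval_def)
next
  case (insert a A)
  obtain P where P: "total_degree P \<le> d" "\<forall>x\<in>S. mpoly_eval P x = 0" "\<forall>x\<in>A. mpoly_eval P x \<noteq> 0"
    using insert.IH insert.prems by auto
  obtain Q where Q: "total_degree Q \<le> d" "\<forall>x\<in>S. mpoly_eval Q x = 0" "mpoly_eval Q a \<noteq> 0"
    using insert.prems by auto
  \<comment> \<open>These quotients are the values of \<open>c\<close> at which
    \<open>P + c Q\<close> vanishes at a point where \<open>Q\<close> does not. Where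
    \<open>Q\<close> vanishes the quotient is 0 by convention, which merely excludes
    \<open>c = 0\<close> as well.\<close>
  obtain c where c: "c \<notin> (\<lambda>x. - mpoly_eval P x / mpoly_eval Q x) ` insert a A"
    using ex_new_if_finite[OF infinite_UNIV_char_0] insert.hyps(1) by (metis finite.insertI finite_imageI)
  have "representable d (\<lambda>x. mpoly_eval P x + c * mpoly_eval Q x)"
    using P(1) Q(1) by (intro representable_add representable_cmult) (auto simp: representable_def)
  then obtain R where R: "total_degree R \<le> d" "\<And>x. mpoly_eval R x = mpoly_eval P x + c * mpoly_eval Q x"
    by (auto simp: representable_def)
  have "mpoly_eval R x \<noteq> 0" if x: "x \<in> insert a A" for x
  proof (cases "mpoly_eval Q x = 0")
    \<comment> \<open>Here \<open>x\<close> cannot be \<open>a\<close>, so it is an old point and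
      \<open>P\<close> is nonzero there.\<close>
    case True
    with x P(3) Q(3) show ?thesis by (auto simp: R(2))
  next
    case False
    have "c \<noteq> - mpoly_eval P x / mpoly_eval Q x" using c x by blast
    with False show ?thesis by (simp add: R(2) field_simps add_eq_0_iff)
  qed
  with P(2) Q(2) R show ?case by auto
qed

lemma grid_point_in_layer:
  assumes "a \<in> grid k"
  shows "\<exists>j\<le>grid_N k. a \<in> layers k {j}"
proof -
  have "\<forall>i. \<exists>t. t \<le> k i - 1 \<and> a $ i = real t" using assms unfolding grid_def by fastforce
  then obtain u where u: "\<And>i. u i \<le> k i - 1" "\<And>i. a $ i = real (u i)" by metis
  have "sum u UNIV \<le> grid_N k" unfolding grid_N_def using u(1) by (intro sum_mono) auto
  moreover have "a \<in> layers k {sum u UNIV}" using assms by (simp add: layers_def wt_def u(2))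
  ultimately show ?thesis by blast
qed

lemma subset_Zstar_cl: "E \<subseteq> {0..grid_N k} \<Longrightarrow> E \<subseteq> Zstar_cl k d E"
  by (auto simp: Zstar_cl_def Zcl_def layers_def)

text \<open>Negating the inclusion of the layer in the closure leaves one witness point and one
  polynomial. The bound on \<open>j\<close> matters: beyond it the layer is empty, yet
  \<open>j\<close> is outside the closure by definition.\<close>

lemma not_in_Zstar_cl_iff:
  assumes "j \<le> grid_N k"
  shows "j \<notin> Zstar_cl k d E \<longleftrightarrow> (\<exists>a\<in>layers k {j}. \<exists>P. total_degree P \<le> d \<and>
    (\<forall>x\<in>layers k E. mpoly_eval P x = 0) \<and> mpoly_eval P a \<noteq> 0)"
  using assms by (auto simp: Zstar_cl_def Zcl_def layers_def)

text \<open>This is (a) at a fixed degree bound: a grid point where a cover is nonzero lies in some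
  layer, whose weight the closure then misses, and conversely.\<close>

lemma nontrivial_cover_iff_Zstar_cl:
  "(\<exists>P. nontrivial_cover k E P \<and> total_degree P \<le> d) \<longleftrightarrow> Zstar_cl k d E \<noteq> {0..grid_N k}"
proof
  assume "\<exists>P. nontrivial_cover k E P \<and> total_degree P \<le> d"
  then obtain P a where P: "total_degree P \<le> d" "\<forall>x\<in>layers k E. mpoly_eval P x = 0"
      and a: "a \<in> grid k" "mpoly_eval P a \<noteq> 0"
    unfolding nontrivial_cover_def zeros_def by blast
  obtain j where j: "j \<le> grid_N k" "a \<in> layers k {j}"
    using grid_point_in_layer a(1) by blast
  then have "j \<notin> Zstar_cl k d E" using not_in_Zstar_cl_iff P a(2) by blast
  with j(1) show "Zstar_cl k d E \<noteq> {0..grid_N k}" by auto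
next
  assume "Zstar_cl k d E \<noteq> {0..grid_N k}"
  then obtain j where "j \<le> grid_N k" "j \<notin> Zstar_cl k d E"
    unfolding Zstar_cl_def by fastforce
  then obtain a P where "a \<in> layers k {j}" "total_degree P \<le> d"
      "\<forall>x\<in>layers k E. mpoly_eval P x = 0" "mpoly_eval P a \<noteq> 0"
    using not_in_Zstar_cl_iff by blast
  then show "\<exists>P. nontrivial_cover k E P \<and> total_degree P \<le> d"
    by (intro exI[of _ P]) (auto simp: nontrivial_cover_def zeros_def layers_def)
qed

lemma proper_cover_iff_Zstar_cl:
  assumes E: "E \<subseteq> {0..grid_N k}"
  shows "(\<exists>P. proper_cover k E P \<and> total_degree P \<le> d) \<longleftrightarrow> Zstar_cl k d E = E"
proof
  assume "\<exists>P. proper_cover k E P \<and> total_degree P \<le> d"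
  then obtain P where P: "total_degree P \<le> d" "layers k E \<subseteq> zeros k P"
      "\<forall>j\<in>{0..grid_N k} - E. \<not> layers k {j} \<subseteq> zeros k P"
    by (auto simp: proper_cover_def)
  have "j \<in> E" if j: "j \<in> Zstar_cl k d E" for j
  proof (rule ccontr)
    assume "j \<notin> E"
    then have "\<not> layers k {j} \<subseteq> zeros k P" using j P(3) by (simp add: Zstar_cl_def)
    \<comment> \<open>\<open>P\<close> is itself one of the polynomials that the closure
      tests.\<close>
    moreover have "layers k {j} \<subseteq> zeros k P"
      using j P(1,2) unfolding Zstar_cl_def Zcl_def zeros_def by blast
    ultimately show False by blast
  qed
  with subset_Zstar_cl[OF E] show "Zstar_cl k d E = E" by blast
next
  assume "Zstar_cl k d E = E"
  then have "\<forall>j\<in>{0..grid_N k} - E. \<exists>a. a \<in> layers k {j} \<and> (\<exists>P. total_degree P \<le> d \<and>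
      (\<forall>x\<in>layers k E. mpoly_eval P x = 0) \<and> mpoly_eval P a \<noteq> 0)"
    using not_in_Zstar_cl_iff[of _ k d E] unfolding Bex_def by auto
  \<comment> \<open>One point \<open>a j\<close> per missing layer is enough for properness, and the
    polynomials depending on \<open>j\<close> can then be merged over this finite set of
    points.\<close>
  then obtain a where a: "\<And>j. j \<in> {0..grid_N k} - E \<Longrightarrow> a j \<in> layers k {j} \<and> (\<exists>P. total_degree P \<le> d \<and>
      (\<forall>x\<in>layers k E. mpoly_eval P x = 0) \<and> mpoly_eval P (a j) \<noteq> 0)"
    by metis
  have "\<exists>P. total_degree P \<le> d \<and> (\<forall>x\<in>layers k E. mpoly_eval P x = 0) \<and>
      (\<forall>b\<in>a ` ({0..grid_N k} - E). mpoly_eval P b \<noteq> 0)"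
  proof (rule common_nonvanishing)
    fix b assume "b \<in> a ` ({0..grid_N k} - E)"
    with a show "\<exists>P. total_degree P \<le> d \<and> (\<forall>x\<in>layers k E. mpoly_eval P x = 0) \<and> mpoly_eval P b \<noteq> 0"
      by blast
  qed simp
  then obtain P where P: "total_degree P \<le> d" "\<forall>x\<in>layers k E. mpoly_eval P x = 0"
      "\<forall>b\<in>a ` ({0..grid_N k} - E). mpoly_eval P b \<noteq> 0"
    by blast
  have "proper_cover k E P"
    unfolding proper_cover_def
  proof (intro conjI ballI)
    show "layers k E \<subseteq> zeros k P" using P(2) by (auto simp: zeros_def layers_def)
    show "\<not> layers k {j} \<subseteq> zeros k P" if "j \<in> {0..grid_N k} - E" for j
      using a[OF that] P(3) that by (auto simp: zeros_def)
  qed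
  with P(1) show "\<exists>P. proper_cover k E P \<and> total_degree P \<le> d" by blast
qed

text \<open>Passes from degrees attained exactly to upper bounds on the degree, the form in which
  closures are stated. The assumption puts \<open>N\<close> in the set, so \<open>Min\<close> is
  taken over a nonempty set.\<close>

lemma Least_degree_eq_Min:
  fixes deg :: "'a \<Rightarrow> nat"
  assumes "\<exists>P. C P \<and> deg P \<le> N"
  shows "(LEAST d. \<exists>P. C P \<and> deg P = d) = Min {d \<in> {0..N}. \<exists>P. C P \<and> deg P \<le> d}"
proof (rule Least_equality)
  let ?M = "{d \<in> {0..N}. \<exists>P. C P \<and> deg P \<le> d}"
  have fin: "finite ?M" by simp
  have le: "Min ?M \<le> deg P" if "C P" for P
  proof (cases "deg P \<le> N")
    case True
    with that show ?thesis by (intro Min_le[OF fin]) auto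
  next
    case False
    \<comment> \<open>Degrees above \<open>N\<close> are cut off from \<open>?M\<close>, so the
      comparison goes through \<open>N\<close>.\<close>
    have "Min ?M \<le> N" using assms by (intro Min_le[OF fin]) auto
    with False show ?thesis by simp
  qed
  have "Min ?M \<in> ?M" using assms by (intro Min_in[OF fin]) auto
  then obtain P where "C P" "deg P \<le> Min ?M" by blast
  with le show "\<exists>P. C P \<and> deg P = Min ?M" by (meson le_antisym)
  show "Min ?M \<le> d" if "\<exists>P. C P \<and> deg P = d" for d using that le by blast
qed

theorem lemma1p6:
  fixes k :: "'n::finite \<Rightarrow> nat" and E :: "nat set"
  assumes "uniform_sides k"
    and "E \<subset> {0..grid_N k}"
  shows "PC k E = Min {d \<in> {0..grid_N k}. Zstar_cl k d E \<noteq> {0..grid_N k}} \<and>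
    PPC k E = Min {d \<in> {0..grid_N k}. Zstar_cl k d E = E}"
proof
  show "PC k E = Min {d \<in> {0..grid_N k}. Zstar_cl k d E \<noteq> {0..grid_N k}}"
    \<comment> \<open>Existence of a cover of degree at most \<open>grid_N k\<close> confines the
      minimum to the stated range; the equivalence then rewrites its defining condition.\<close>
    unfolding PC_def Least_degree_eq_Min[OF nontrivial_cover_exists[OF assms(2)]]
      nontrivial_cover_iff_Zstar_cl ..
  show "PPC k E = Min {d \<in> {0..grid_N k}. Zstar_cl k d E = E}"
    unfolding PPC_def Least_degree_eq_Min[OF proper_cover_exists]
      proper_cover_iff_Zstar_cl[OF psubset_imp_subset[OF assms(2)]] ..
qed

end
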